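(* (Parameterized Deduction Theorem.) Let $\varepsilon,\varepsilon'$ be positive rationals, $\phi\in\mathcal L^+$ and $\psi\in\mathcal L$. 1. If $\vdash_{\varepsilon'+\varepsilon}(\phi\to\psi)$ and $\vdash_{\varepsilon'}\phi$, then $\vdash_{\varepsilon'+\varepsilon}\psi$. 2. If $\vdash_{\varepsilon'+\varepsilon}(\neg\psi\to\neg\phi)$ and $\vdash_{\varepsilon'}\phi$, then $\vdash_{\varepsilon'+\varepsilon}\psi$.
   Context: Formulae $\mathcal L$: $\phi::=\top\mid\neg\phi\mid\phi\land\phi\mid L_r\phi$, $r$ a nonnegative rational; other Boolean connectives are abbreviations, $\bot=\neg\top$. $\mathcal L^+$ is the sublanguage generated by $\psi::=\top\mid\psi\land\psi\mid\psi\lor\psi\mid L_r\psi$. $\varepsilon$-provability ($\varepsilon\ge 0$ rational): $\vdash_\varepsilon$ is the proof system consisting of classical propositional logic together with, for all $\phi,\psi\in\mathcal L$ and nonnegative rationals $r,s$: (A1) $L_\varepsilon\phi$; (A2) $L_{r+s}\phi\to L_r\phi$; (A3) $L_r(\phi\land\psi)\land L_s(\phi\land\neg\psi)\to L_{r+s-\varepsilon}\phi$; (A4) $\neg L_r(\phi\land\psi)\land\neg L_s(\phi\land\neg\psi)\to\neg L_{r+s-\varepsilon}\phi$; (R1) from $\vdash_\varepsilon\phi\to\psi$ infer $\vdash_\varepsilon L_r\phi\to L_r\psi$; (R2) from all of $\{L_r\phi\mid r<s\}$ infer $L_s\phi$; (R3) from all of $\{L_r\phi\mid r>s\}$ infer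 $\bot$. $\vdash_\varepsilon\phi$ means $\phi$ is derivable. *)

theory Defs
  imports Complex_Main
begin

typedef nnrat = "{r :: rat. 0 \<le> r}"
  morphisms rat_of_nnrat nnrat_of_rat
  by auto

setup_lifting type_definition_nnrat

(* The difference is truncated at 0, as on nat; in every use below it is guarded so that
   it coincides with subtraction of rationals. *)
instantiation nnrat :: "{ordered_cancel_comm_monoid_diff, linorder}"
begin

lift_definition zero_nnrat :: nnrat is 0 by simp
lift_definition plus_nnrat :: "nnrat \<Rightarrow> nnrat \<Rightarrow> nnrat" is "(+)" by simp
lift_definition minus_nnrat :: "nnrat \<Rightarrow> nnrat \<Rightarrow> nnrat" is "\<lambda>r s. max 0 (r - s)" by simp
lift_definition less_eq_nnrat :: "nnrat \<Rightarrow> nnrat \<Rightarrow> bool" is "(\<le>)" .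
lift_definition less_nnrat :: "nnrat \<Rightarrow> nnrat \<Rightarrow> bool" is "(<)" .

instance
proof
  fix a b :: nnrat
  show "(a \<le> b) = (\<exists>c. b = a + c)"
  proof
    assume "a \<le> b"
    then have "b = a + (b - a)" by transfer simp
    then show "\<exists>c. b = a + c" ..
  next
    assume "\<exists>c. b = a + c"
    then show "a \<le> b" by transfer auto
  qed
qed (transfer; auto simp: max_def)+

end

datatype fm =
    Top (\<open>\<^bold>\<top>\<close>)
  | Neg fm (\<open>\<^bold>\<not> _\<close> [75] 75)
  | Con fm fm (infixr \<open>\<^bold>\<and>\<close> 65)
  | L nnrat fm

abbreviation Bot :: fm (\<open>\<^bold>\<bottom>\<close>)
  where "\<^bold>\<bottom> \<equiv> \<^bold>\<not> \<^bold>\<top>"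

abbreviation Dis :: "fm \<Rightarrow> fm \<Rightarrow> fm" (infixr \<open>\<^bold>\<or>\<close> 60)
  where "\<phi> \<^bold>\<or> \<psi> \<equiv> \<^bold>\<not> (\<^bold>\<not> \<phi> \<^bold>\<and> \<^bold>\<not> \<psi>)"

abbreviation Imp :: "fm \<Rightarrow> fm \<Rightarrow> fm" (infixr \<open>\<^bold>\<longrightarrow>\<close> 55)
  where "\<phi> \<^bold>\<longrightarrow> \<psi> \<equiv> \<^bold>\<not> (\<phi> \<^bold>\<and> \<^bold>\<not> \<psi>)"

inductive_set L_plus :: "fm set" where
  Top: "\<^bold>\<top> \<in> L_plus"
| Con: "\<phi> \<in> L_plus \<Longrightarrow> \<psi> \<in> L_plus \<Longrightarrow> \<phi> \<^bold>\<and> \<psi> \<in> L_plus"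
| Dis: "\<phi> \<in> L_plus \<Longrightarrow> \<psi> \<in> L_plus \<Longrightarrow> \<phi> \<^bold>\<or> \<psi> \<in> L_plus"
| L: "\<phi> \<in> L_plus \<Longrightarrow> L r \<phi> \<in> L_plus"

(* Propositional evaluation: formulas L r \<phi> are treated as atoms, with truth values
   prescribed by v. *)
primrec prop_eval :: "(nnrat \<Rightarrow> fm \<Rightarrow> bool) \<Rightarrow> fm \<Rightarrow> bool" where
  "prop_eval v \<^bold>\<top> = True"
| "prop_eval v (\<^bold>\<not> \<phi>) = (\<not> prop_eval v \<phi>)"
| "prop_eval v (\<phi> \<^bold>\<and> \<psi>) = (prop_eval v \<phi> \<and> prop_eval v \<psi>)"
| "prop_eval v (L r \<phi>) = v r \<phi>"

definition tautology :: "fm \<Rightarrow> bool" where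
  "tautology \<phi> \<longleftrightarrow> (\<forall>v. prop_eval v \<phi>)"

(* Classical propositional logic enters as Taut and MP. The guards in A3 and A4 say that
   r + s - \<epsilon> is an admissible (nonnegative) index; R2 and R3 have infinitely many premises. *)
inductive provable :: "nnrat \<Rightarrow> fm \<Rightarrow> bool" (\<open>\<turnstile>\<^bsub>_\<^esub> _\<close> [0, 50] 50) for \<epsilon> :: nnrat where
  Taut: "tautology \<phi> \<Longrightarrow> \<turnstile>\<^bsub>\<epsilon>\<^esub> \<phi>"
| MP: "\<turnstile>\<^bsub>\<epsilon>\<^esub> \<phi> \<^bold>\<longrightarrow> \<psi> \<Longrightarrow> \<turnstile>\<^bsub>\<epsilon>\<^esub> \<phi> \<Longrightarrow> \<turnstile>\<^bsub>\<epsilon>\<^esub> \<psi>"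
| A1: "\<turnstile>\<^bsub>\<epsilon>\<^esub> L \<epsilon> \<phi>"
| A2: "\<turnstile>\<^bsub>\<epsilon>\<^esub> L (r + s) \<phi> \<^bold>\<longrightarrow> L r \<phi>"
| A3: "\<epsilon> \<le> r + s \<Longrightarrow>
    \<turnstile>\<^bsub>\<epsilon>\<^esub> L r (\<phi> \<^bold>\<and> \<psi>) \<^bold>\<and> L s (\<phi> \<^bold>\<and> \<^bold>\<not> \<psi>) \<^bold>\<longrightarrow> L (r + s - \<epsilon>) \<phi>"
| A4: "\<epsilon> \<le> r + s \<Longrightarrow>
    \<turnstile>\<^bsub>\<epsilon>\<^esub> \<^bold>\<not> L r (\<phi> \<^bold>\<and> \<psi>) \<^bold>\<and> \<^bold>\<not> L s (\<phi> \<^bold>\<and> \<^bold>\<not> \<psi>) \<^bold>\<longrightarrow> \<^bold>\<not> L (r + s - \<epsilon>) \<phi>"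
| R1: "\<turnstile>\<^bsub>\<epsilon>\<^esub> \<phi> \<^bold>\<longrightarrow> \<psi> \<Longrightarrow> \<turnstile>\<^bsub>\<epsilon>\<^esub> L r \<phi> \<^bold>\<longrightarrow> L r \<psi>"
| R2: "(\<And>r. r < s \<Longrightarrow> \<turnstile>\<^bsub>\<epsilon>\<^esub> L r \<phi>) \<Longrightarrow> \<turnstile>\<^bsub>\<epsilon>\<^esub> L s \<phi>"
| R3: "(\<And>r. r > s \<Longrightarrow> \<turnstile>\<^bsub>\<epsilon>\<^esub> L r \<phi>) \<Longrightarrow> \<turnstile>\<^bsub>\<epsilon>\<^esub> \<^bold>\<bottom>"

end

(* The measure that vanishes everywhere makes L r \<phi> true exactly when r \<le> \<epsilon>, and this single
   valuation is sound for provability at \<epsilon>. Conversely, a positive formula true under it holds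
   only because of atoms L r \<phi> with r \<le> \<epsilon>, and these follow from A1 and A2 at every
   parameter \<ge> \<epsilon>. Hence provability of positive formulas is monotone in the parameter. *)
theory Submission
  imports Defs
begin

text \<open>Density is what makes the infinitary rule \<open>R2\<close> sound for the zero
  measure.\<close>

instance nnrat :: dense_linorder
proof
  fix x y :: nnrat
  assume "x < y"
  then show "\<exists>z. x < z \<and> z < y"
  proof transfer
    fix x y :: rat
    assume "0 \<le> x" "x < y"
    then obtain z where "x < z" "z < y"
      using dense by blast
    with \<open>0 \<le> x\<close> show "\<exists>z\<in>{r. 0 \<le> r}. x < z \<and> z < y"
      by (intro bexI[of _ z]) auto
  qed
qed

instance nnrat :: no_top
proof
  fix x :: nnrat
  show "\<exists>y. x < y"
    by transfer (metis gt_ex less_eq_rat_def mem_Collect_eq order_less_trans)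
qed

text \<open>The valuation looks only at the index of an atom. Hence \<open>R1\<close> is immediate
  and the axioms reduce to arithmetic on indices.\<close>

lemma provable_zero_measure:
  assumes "\<turnstile>\<^bsub>\<epsilon>\<^esub> \<phi>"
  shows "prop_eval (\<lambda>r _. r \<le> \<epsilon>) \<phi>"
  using assms
proof induction
  case (Taut \<phi>)
  then show ?case by (simp add: tautology_def)
next
  case (A2 r s \<phi>)
  have "r \<le> \<epsilon>" if "r + s \<le> \<epsilon>"
    using that by transfer simp
  then show ?case by auto
next
  case (A3 r s \<phi> \<psi>)
  have "r + s - \<epsilon> \<le> \<epsilon>" if "r \<le> \<epsilon>" "s \<le> \<epsilon>"
    using that by transfer simp
  then show ?case by auto
next
  case (A4 r s \<phi> \<psi>)
  \<comment> \<open>If both indices exceeded \<epsilon>, then r + s - \<epsilon> would exceed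
    \<epsilon> as well.\<close>
  have "r \<le> \<epsilon> \<or> s \<le> \<epsilon>" if "r + s - \<epsilon> \<le> \<epsilon>"
    using that by transfer auto
  then show ?case by auto
next
  case (R2 s \<phi>)
  then show ?case by (auto intro: dense_le[of s])
next
  case (R3 s \<phi>)
  \<comment> \<open>An index above s is covered by the premises of \<open>R3\<close>, while above
    \<epsilon> the atom is false: the premises are contradictory.\<close>
  obtain r where "max s \<epsilon> < r"
    using gt_ex by blast
  with R3.IH[of r] show ?case by auto
qed auto

lemma provable_Con:
  assumes "\<turnstile>\<^bsub>\<epsilon>\<^esub> \<phi>" and "\<turnstile>\<^bsub>\<epsilon>\<^esub> \<psi>"
  shows "\<turnstile>\<^bsub>\<epsilon>\<^esub> \<phi> \<^bold>\<and> \<psi>"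
proof -
  have "\<turnstile>\<^bsub>\<epsilon>\<^esub> \<phi> \<^bold>\<longrightarrow> \<psi> \<^bold>\<longrightarrow> \<phi> \<^bold>\<and> \<psi>"
    by (rule Taut) (simp add: tautology_def)
  then show ?thesis
    using assms MP by blast
qed

lemma provable_DisI1:
  assumes "\<turnstile>\<^bsub>\<epsilon>\<^esub> \<phi>"
  shows "\<turnstile>\<^bsub>\<epsilon>\<^esub> \<phi> \<^bold>\<or> \<psi>"
proof -
  have "\<turnstile>\<^bsub>\<epsilon>\<^esub> \<phi> \<^bold>\<longrightarrow> \<phi> \<^bold>\<or> \<psi>"
    by (rule Taut) (simp add: tautology_def)
  then show ?thesis
    using assms by (rule MP)
qed

lemma provable_DisI2:
  assumes "\<turnstile>\<^bsub>\<epsilon>\<^esub> \<psi>"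
  shows "\<turnstile>\<^bsub>\<epsilon>\<^esub> \<phi> \<^bold>\<or> \<psi>"
proof -
  have "\<turnstile>\<^bsub>\<epsilon>\<^esub> \<psi> \<^bold>\<longrightarrow> \<phi> \<^bold>\<or> \<psi>"
    by (rule Taut) (simp add: tautology_def)
  then show ?thesis
    using assms by (rule MP)
qed

lemma provable_L:
  assumes "r \<le> \<epsilon>"
  shows "\<turnstile>\<^bsub>\<epsilon>\<^esub> L r \<phi>"
proof -
  obtain s where "\<epsilon> = r + s"
    using assms le_iff_add by blast
  then show ?thesis
    using A1 A2 MP by metis
qed

text \<open>Induction on positive formulas: the valuation decides which disjunct to derive, and a
  true atom has index at most \<epsilon>, hence at most \<delta>.\<close>

lemma provable_if_zero_measure:
  assumes "\<phi> \<in> L_plus" and "\<epsilon> \<le> \<delta>" and "prop_eval (\<lambda>r _. r \<le> \<epsilon>) \<phi>"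
  shows "\<turnstile>\<^bsub>\<delta>\<^esub> \<phi>"
  using assms(1,3)
proof induction
  case Top
  show ?case by (rule Taut) (simp add: tautology_def)
next
  case (Con \<phi> \<psi>)
  then show ?case by (simp add: provable_Con)
next
  case (Dis \<phi> \<psi>)
  then show ?case by (auto intro: provable_DisI1 provable_DisI2)
next
  case (L \<phi> r)
  then show ?case using \<open>\<epsilon> \<le> \<delta>\<close> by (auto intro: provable_L)
qed

text \<open>The derivation at \<epsilon> is not replayed, since the indices in \<open>A3\<close> and
  \<open>A4\<close> depend on the parameter. It only yields truth under the zero measure, from which
  a new derivation at \<delta> is built.\<close>

corollary provable_L_plus_mono:
  assumes "\<phi> \<in> L_plus" and "\<epsilon> \<le> \<delta>" and "\<turnstile>\<^bsub>\<epsilon>\<^esub> \<phi>"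
  shows "\<turnstile>\<^bsub>\<delta>\<^esub> \<phi>"
  using assms provable_if_zero_measure provable_zero_measure by blast

lemma provable_contrapos:
  assumes "\<turnstile>\<^bsub>\<epsilon>\<^esub> \<^bold>\<not> \<psi> \<^bold>\<longrightarrow> \<^bold>\<not> \<phi>"
  shows "\<turnstile>\<^bsub>\<epsilon>\<^esub> \<phi> \<^bold>\<longrightarrow> \<psi>"
proof -
  have "\<turnstile>\<^bsub>\<epsilon>\<^esub> (\<^bold>\<not> \<psi> \<^bold>\<longrightarrow> \<^bold>\<not> \<phi>) \<^bold>\<longrightarrow> \<phi> \<^bold>\<longrightarrow> \<psi>"
    by (rule Taut) (auto simp: tautology_def)
  then show ?thesis
    using assms by (rule MP)
qed

theorem theorem4:
  fixes \<epsilon> \<epsilon>' :: nnrat and \<phi> \<psi> :: fm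
  assumes "0 < \<epsilon>" and "0 < \<epsilon>'" and "\<phi> \<in> L_plus"
  shows "((\<turnstile>\<^bsub>\<epsilon>' + \<epsilon>\<^esub> \<phi> \<^bold>\<longrightarrow> \<psi>) \<and> (\<turnstile>\<^bsub>\<epsilon>'\<^esub> \<phi>) \<longrightarrow> (\<turnstile>\<^bsub>\<epsilon>' + \<epsilon>\<^esub> \<psi>)) \<and>
         ((\<turnstile>\<^bsub>\<epsilon>' + \<epsilon>\<^esub> \<^bold>\<not> \<psi> \<^bold>\<longrightarrow> \<^bold>\<not> \<phi>) \<and> (\<turnstile>\<^bsub>\<epsilon>'\<^esub> \<phi>) \<longrightarrow> (\<turnstile>\<^bsub>\<epsilon>' + \<epsilon>\<^esub> \<psi>))"
proof -
  have "\<epsilon>' \<le> \<epsilon>' + \<epsilon>"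
    by (simp add: le_iff_add)
  \<comment> \<open>Raising \<phi> to the parameter of the implication lets \<open>MP\<close> apply;
    the second part reduces to the first by contraposition.\<close>
  then have "\<turnstile>\<^bsub>\<epsilon>' + \<epsilon>\<^esub> \<phi>" if "\<turnstile>\<^bsub>\<epsilon>'\<^esub> \<phi>"
    using that assms(3) provable_L_plus_mono by blast
  then show ?thesis
    using MP provable_contrapos by blast
qed

end
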